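(* Let $n \ge 3$ and consider the chain (path graph) with vertices $1,\dots,n$ and edges $\{p,p+1\}$, $1\le p\le n-1$. Let $P\in\mathbb{R}^n$ satisfy $\sum_{p=1}^n P_p = 0$, let $p_i = P\cdot \mathbf{v}^i$ for $1\le i\le n$, let $\theta\in\mathbb{R}^n$ be a solution of $-\Delta\theta = P$, and let $P_l = \nabla\theta$. For $2\le k\le n-1$ define $$s_k^2 = \sum_{i=2}^k \frac{p_i^2}{\omega_i^2},\qquad \delta_k = \|P_l\|_2^2 - s_k^2 .$$ Then for every integer $k$ with $2\le k\le n-1$, $$\delta_k \le \frac{n}{2\pi}\,\Big(\max_{k+1\le i\le n} p_i^2\Big)\left[\cot\frac{\pi(k-1)}{2n} - \cot\frac{\pi(n-1)}{2n}\right].$$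
   Context: Here $\nabla$ is the discrete gradient of the chain, the $(n-1)\times n$ matrix given by $(\nabla\theta)_p = \theta_{p+1}-\theta_p$ (up to the choice of orientation of each edge), and $\Delta=\nabla^T\nabla$ is the graph Laplacian of the chain. Its eigenvalues and corresponding orthonormal eigenvectors are, for $i=1,\dots,n$, $$\omega_i^2 = 4\sin^2\frac{\pi(i-1)}{2n},\qquad \mathbf{v}^i_p = \frac{1}{N_i}\cos\Big[\frac{\pi(i-1)}{n}\Big(p-\frac12\Big)\Big],\quad p=1,\dots,n,$$ with $N_1=\sqrt{n}$ and $N_i=\sqrt{n/2}$ for $i\ge 2$. The notation $s_k^2$ is a name for the partial sum (it is not the square of a separately defined quantity). $\|\cdot\|_2$ is the Euclidean norm. *)

theory Defs
  imports
    "Jordan_Normal_Form.Matrix"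
    "HOL-Analysis.L2_Norm"
begin

text \<open>
  Library vectors and matrices are indexed from 0, so the vertex \<open>p\<close> of the chain is index
  \<open>p - 1\<close>, and row \<open>e\<close> of the gradient is the edge between the indices \<open>e\<close> and \<open>e + 1\<close>.
  Eigenvector indices \<open>i\<close> keep their range from 1 to \<open>n\<close>.
\<close>

text \<open>
  The sign \<open>\<epsilon> e\<close>, which is 1 or -1, is the chosen orientation of edge \<open>e\<close>; with \<open>\<epsilon> e = 1\<close>
  for all \<open>e\<close> the gradient of \<open>\<theta>\<close> has the entries \<open>\<theta> (e + 1) - \<theta> e\<close>.
\<close>

definition chain_grad :: "nat \<Rightarrow> (nat \<Rightarrow> real) \<Rightarrow> real mat" where
  "chain_grad n \<epsilon> =
     mat (n - 1) n (\<lambda>(e, q). if q = e + 1 then \<epsilon> e else if q = e then - \<epsilon> e else 0)"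

definition chain_laplacian :: "nat \<Rightarrow> (nat \<Rightarrow> real) \<Rightarrow> real mat" where
  "chain_laplacian n \<epsilon> = transpose_mat (chain_grad n \<epsilon>) * chain_grad n \<epsilon>"

definition chain_eigval :: "nat \<Rightarrow> nat \<Rightarrow> real" where
  "chain_eigval n i = 4 * (sin (pi * (real i - 1) / (2 * real n)))\<^sup>2"

definition chain_eigvec_norm :: "nat \<Rightarrow> nat \<Rightarrow> real" where
  "chain_eigvec_norm n i = (if i = 1 then sqrt (real n) else sqrt (real n / 2))"

definition chain_eigvec :: "nat \<Rightarrow> nat \<Rightarrow> real vec" where
  "chain_eigvec n i =
     vec n (\<lambda>q. 1 / chain_eigvec_norm n i
                 * cos (pi * (real i - 1) / real n * (real (q + 1) - 1 / 2)))"

definition chain_coeff :: "nat \<Rightarrow> real vec \<Rightarrow> nat \<Rightarrow> real" where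
  "chain_coeff n P i = scalar_prod P (chain_eigvec n i)"

definition euclidean_norm_vec :: "real vec \<Rightarrow> real" where
  "euclidean_norm_vec v = L2_set (vec_index v) {..<dim_vec v}"

definition line_flow :: "nat \<Rightarrow> (nat \<Rightarrow> real) \<Rightarrow> real vec \<Rightarrow> real vec" where
  "line_flow n \<epsilon> \<theta> = mult_mat_vec (chain_grad n \<epsilon>) \<theta>"

text \<open>The value is the quantity written \<open>s\<^sub>k\<^sup>2\<close>; the square is part of the name.\<close>

definition s_squared :: "nat \<Rightarrow> real vec \<Rightarrow> nat \<Rightarrow> real" where
  "s_squared n P k = (\<Sum>i = 2..k. (chain_coeff n P i)\<^sup>2 / chain_eigval n i)"

definition delta :: "nat \<Rightarrow> (nat \<Rightarrow> real) \<Rightarrow> real vec \<Rightarrow> real vec \<Rightarrow> nat \<Rightarrow> real" where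
  "delta n \<epsilon> P \<theta> k = (euclidean_norm_vec (line_flow n \<epsilon> \<theta>))\<^sup>2 - s_squared n P k"

end

theory Submission
  imports Defs
begin

text \<open>
  Summation by parts shows that the cosine vectors satisfy the eigenvector equation weakly, so
  \<open>p\<^sub>i = - \<omega>\<^sub>i\<^sup>2 (\<theta> \<bullet> v\<^sup>i)\<close>. Completeness of the cosine vectors then gives
  \<open>\<parallel>\<nabla>\<theta>\<parallel>\<^sup>2 = - P \<bullet> \<theta> = (\<Sum>i\<ge>2. p\<^sub>i\<^sup>2 / \<omega>\<^sub>i\<^sup>2)\<close>, and \<open>\<delta>\<^sub>k\<close> is the tail of this sum.
  The tail of \<open>1 / (4 sin\<^sup>2)\<close> is bounded by the telescoping differences of its primitive
  \<open>- cot / 4\<close>, because \<open>1 / sin\<^sup>2\<close> decreases on \<open>(0, \<pi>/2]\<close>.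
\<close>

section \<open>Cosine sums, completeness of the eigenvectors and Parseval's identity\<close>

text \<open>The factor \<open>2 * sin (x / 2)\<close> turns each cosine into a difference of sines
  at neighbouring half-odd multiples of \<open>x\<close>, and these telescope.\<close>

lemma sum_cos_dirichlet:
  fixes x :: real
  shows "2 * sin (x / 2) * (\<Sum>i<n. cos (real (Suc i) * x)) = sin ((real n + 1 / 2) * x) - sin (x / 2)"
proof (induction n)
  case 0
  show ?case by simp
next
  case (Suc n)
  have "2 * (sin (x / 2) * cos (real (Suc n) * x))
      = sin (x / 2 + real (Suc n) * x) + sin (x / 2 - real (Suc n) * x)"
    by (simp add: sin_times_cos)
  also have "x / 2 + real (Suc n) * x = (real (Suc n) + 1 / 2) * x"
    by (simp add: algebra_simps)
  also have "x / 2 - real (Suc n) * x = - ((real n + 1 / 2) * x)"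
    by (simp add: algebra_simps)
  finally have "2 * sin (x / 2) * cos (real (Suc n) * x)
      = sin ((real (Suc n) + 1 / 2) * x) - sin ((real n + 1 / 2) * x)"
    by (simp only: sin_minus)
  with Suc.IH show ?case
    by (simp only: sum.lessThan_Suc distrib_left)
qed

text \<open>The last sine of the telescoped sum sits at \<open>m * pi - x / 2\<close>, so only the
  parity of \<open>m\<close> survives. The bounds on \<open>m\<close> put \<open>x / 2\<close>
  strictly between 0 and \<pi>, which allows \<open>sin (x / 2)\<close> to be cancelled.\<close>

lemma sum_cos_pi_multiples:
  fixes m n :: nat
  assumes "0 < m" "m < 2 * n"
  shows "(\<Sum>i<n - 1. cos (real (Suc i) * (pi * real m / real n))) = - (1 + (- 1) ^ m) / 2"
proof -
  define x where "x = pi * real m / real n"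
  have n: "n > 0" using assms by simp
  have "0 < x / 2" "x / 2 < pi"
    using assms n by (simp_all add: x_def field_simps)
  then have pos: "sin (x / 2) > 0" by (rule sin_gt_zero)
  have "(real (n - 1) + 1 / 2) * x = real m * pi - x / 2"
    using n by (simp add: x_def of_nat_diff field_simps)
  then have "sin ((real (n - 1) + 1 / 2) * x) = - ((- 1) ^ m * sin (x / 2))"
    by (simp add: sin_diff)
  with sum_cos_dirichlet[of x "n - 1"]
  have "2 * sin (x / 2) * (\<Sum>i<n - 1. cos (real (Suc i) * x)) = - (1 + (- 1) ^ m) * sin (x / 2)"
    by (simp add: algebra_simps)
  then have "sin (x / 2) * (2 * (\<Sum>i<n - 1. cos (real (Suc i) * x)))
      = sin (x / 2) * (- (1 + (- 1) ^ m))"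
    by (simp only: mult_ac)
  then show ?thesis
    using pos unfolding x_def[symmetric] by (simp only: mult_cancel_left) simp
qed

text \<open>Summing over the eigenvector index instead of the vertex gives the resolution of the
  identity directly, so no dimension count is needed to expand vectors. Product-to-sum reduces it to
  cosine sums at the multiples \<open>p - q\<close> and \<open>p + q + 1\<close>.\<close>

lemma chain_eigvec_completeness:
  assumes "p < n" "q < n"
  shows "(\<Sum>i = 1..n. chain_eigvec n i $ p * chain_eigvec n i $ q) = (if p = q then 1 else 0)"
proof -
  \<comment> \<open>By symmetry \<open>q \<le> p\<close> may be assumed, which makes the natural
    number \<open>p - q\<close> the true difference.\<close>
  have *: "(\<Sum>i = 1..n. chain_eigvec n i $ p * chain_eigvec n i $ q) = (if p = q then 1 else 0)"
    if pq: "p < n" "q < n" "q \<le> p" for p q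
  proof -
    have n: "n > 0" using pq by simp
    define f where "f m i = cos (real (Suc i) * (pi * real m / real n))" for m i :: nat
    \<comment> \<open>The constant vector is separated because its norm is \<open>sqrt n\<close> and
      not \<open>sqrt (n / 2)\<close>.\<close>
    have fst: "chain_eigvec n 1 $ p * chain_eigvec n 1 $ q = 1 / real n"
      using pq by (simp add: chain_eigvec_def chain_eigvec_norm_def)
    have rest: "chain_eigvec n (Suc (Suc i)) $ p * chain_eigvec n (Suc (Suc i)) $ q
        = (f (p - q) i + f (p + q + 1) i) / real n" for i
    proof -
      define a b where "a = pi * real (Suc i) / real n * (real (p + 1) - 1 / 2)"
        and "b = pi * real (Suc i) / real n * (real (q + 1) - 1 / 2)"
      have diff: "a - b = real (Suc i) * (pi * real (p - q) / real n)"
        and add: "a + b = real (Suc i) * (pi * real (p + q + 1) / real n)"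
        using pq n by (simp_all add: a_def b_def of_nat_diff field_simps)
      have "chain_eigvec n (Suc (Suc i)) $ p * chain_eigvec n (Suc (Suc i)) $ q
          = 1 / (sqrt (real n / 2))\<^sup>2 * (cos a * cos b)"
        using pq by (simp add: chain_eigvec_def chain_eigvec_norm_def a_def b_def power2_eq_square
            del: real_sqrt_pow2 real_sqrt_mult_self)
      also have "\<dots> = 2 / real n * (cos a * cos b)"
        by simp
      also have "\<dots> = (cos (a - b) + cos (a + b)) / real n"
        using n by (simp add: cos_times_cos divide_simps)
      finally show ?thesis unfolding diff add f_def .
    qed
    have "(\<Sum>i = 1..n. chain_eigvec n i $ p * chain_eigvec n i $ q)
        = (\<Sum>i<n. chain_eigvec n (Suc i) $ p * chain_eigvec n (Suc i) $ q)"
      by (rule sum.reindex_bij_witness[of _ Suc "\<lambda>i. i - 1"]) auto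
    also have "\<dots> = (\<Sum>i<Suc (n - 1). chain_eigvec n (Suc i) $ p * chain_eigvec n (Suc i) $ q)"
      using n by simp
    also have "\<dots> = 1 / real n + (\<Sum>i<n - 1. (f (p - q) i + f (p + q + 1) i) / real n)"
      unfolding sum.lessThan_Suc_shift rest using fst by simp
    also have "\<dots> = (1 + (\<Sum>i<n - 1. f (p - q) i) + (\<Sum>i<n - 1. f (p + q + 1) i)) / real n"
      by (simp add: sum.distrib add_divide_distrib flip: sum_divide_distrib)
    also have "(\<Sum>i<n - 1. f (p + q + 1) i) = - (1 + (- 1) ^ (p + q + 1)) / 2"
      unfolding f_def by (rule sum_cos_pi_multiples) (use pq in auto)
    finally have eq: "(\<Sum>i = 1..n. chain_eigvec n i $ p * chain_eigvec n i $ q)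
      = (1 + (\<Sum>i<n - 1. f (p - q) i) + - (1 + (- 1) ^ (p + q + 1)) / 2) / real n" .
    show ?thesis
    proof (cases "p = q")
      case True
      \<comment> \<open>On the diagonal the first sum is \<open>n - 1\<close>, and the second
        vanishes because \<open>2 * p + 1\<close> is odd.\<close>
      then show ?thesis unfolding eq using n by (simp add: f_def of_nat_diff)
    next
      case False
      have "(\<Sum>i<n - 1. f (p - q) i) = - (1 + (- 1) ^ (p - q)) / 2"
        unfolding f_def by (rule sum_cos_pi_multiples) (use pq False in auto)
      \<comment> \<open>\<open>p + q + 1\<close> and \<open>p - q\<close> have opposite parity, so
        the two cosine sums add up to -1 and cancel the contribution of the constant vector.\<close>
      moreover have "(- 1 :: real) ^ (p + q + 1) = - ((- 1) ^ (p - q))"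
        using pq by (simp add: minus_one_power_iff)
      ultimately show ?thesis unfolding eq using False by (simp add: field_simps)
    qed
  qed
  show ?thesis
  proof (cases "q \<le> p")
    case True
    then show ?thesis using * assms by blast
  next
    case False
    then show ?thesis using *[of q p] assms by (simp add: mult.commute)
  qed
qed

lemma dim_chain_eigvec [simp]: "dim_vec (chain_eigvec n i) = n"
  by (simp add: chain_eigvec_def)

lemma chain_eigvec_carrier [simp]: "chain_eigvec n i \<in> carrier_vec n"
  by (simp add: chain_eigvec_def)

lemma chain_parseval:
  assumes u: "u \<in> carrier_vec n" and w: "w \<in> carrier_vec n"
  shows "u \<bullet> w = (\<Sum>i = 1..n. chain_coeff n u i * chain_coeff n w i)"
proof -
  let ?v = "chain_eigvec n"
  have "(\<Sum>i = 1..n. chain_coeff n u i * chain_coeff n w i)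
      = (\<Sum>i = 1..n. \<Sum>p<n. \<Sum>q<n. (u $ p * w $ q) * (?v i $ p * ?v i $ q))"
    by (simp add: chain_coeff_def scalar_prod_def sum_product lessThan_atLeast0 mult_ac)
  also have "\<dots> = (\<Sum>p<n. \<Sum>q<n. \<Sum>i = 1..n. (u $ p * w $ q) * (?v i $ p * ?v i $ q))"
    by (subst sum.swap, rule sum.cong[OF refl], rule sum.swap)
  also have "\<dots> = (\<Sum>p<n. \<Sum>q<n. (u $ p * w $ q) * (if p = q then 1 else 0))"
    unfolding sum_distrib_left[symmetric] by (simp add: chain_eigvec_completeness del: One_nat_def)
  also have "\<dots> = (\<Sum>p<n. u $ p * w $ p)"
    by (simp add: if_distrib[of "\<lambda>x. _ * x"] cong: if_cong)
  also have "\<dots> = u \<bullet> w"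
    using w by (simp add: scalar_prod_def lessThan_atLeast0)
  finally show ?thesis by simp
qed

section \<open>The gradient and the weak eigenvector equation\<close>

lemma dim_chain_grad [simp]:
  "dim_row (chain_grad n \<epsilon>) = n - 1" "dim_col (chain_grad n \<epsilon>) = n"
  by (simp_all add: chain_grad_def)

lemma chain_grad_carrier: "chain_grad n \<epsilon> \<in> carrier_mat (n - 1) n"
  by (rule carrier_matI) (rule dim_chain_grad)+

lemma dim_chain_laplacian [simp]:
  "dim_row (chain_laplacian n \<epsilon>) = n" "dim_col (chain_laplacian n \<epsilon>) = n"
  by (simp_all add: chain_laplacian_def)

lemma dim_line_flow [simp]: "dim_vec (line_flow n \<epsilon> \<theta>) = n - 1"
  by (simp add: line_flow_def)

lemma line_flow_carrier: "line_flow n \<epsilon> \<theta> \<in> carrier_vec (n - 1)"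
  by (rule carrier_vecI) (rule dim_line_flow)

lemma line_flow_index:
  assumes "e < n - 1" "\<theta> \<in> carrier_vec n"
  shows "line_flow n \<epsilon> \<theta> $ e = \<epsilon> e * (\<theta> $ Suc e - \<theta> $ e)"
proof -
  have "line_flow n \<epsilon> \<theta> $ e
      = (\<Sum>q = 0..<n. (if q = Suc e then \<epsilon> e else if q = e then - \<epsilon> e else 0) * \<theta> $ q)"
    using assms by (simp add: line_flow_def chain_grad_def scalar_prod_def)
  also have "\<dots> = (\<Sum>q = 0..<n. (if q = Suc e then \<epsilon> e * \<theta> $ q else 0)
      - (if q = e then \<epsilon> e * \<theta> $ q else 0))"
    by (rule sum.cong) auto
  also have "\<dots> = \<epsilon> e * (\<theta> $ Suc e - \<theta> $ e)"
    using assms by (simp add: sum_subtractf right_diff_distrib)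
  finally show ?thesis .
qed

text \<open>The transpose is the adjoint of the gradient. This form lets the eigenvector equation be
  tested with first differences, without computing entries of the Laplacian.\<close>

lemma chain_laplacian_scalar_prod:
  assumes "\<theta> \<in> carrier_vec n" "\<phi> \<in> carrier_vec n"
  shows "(chain_laplacian n \<epsilon> *\<^sub>v \<theta>) \<bullet> \<phi> = line_flow n \<epsilon> \<theta> \<bullet> line_flow n \<epsilon> \<phi>"
proof -
  have "chain_laplacian n \<epsilon> *\<^sub>v \<theta> = transpose_mat (chain_grad n \<epsilon>) *\<^sub>v line_flow n \<epsilon> \<theta>"
    unfolding chain_laplacian_def line_flow_def
    by (rule assoc_mult_mat_vec[OF transpose_carrier_mat[THEN iffD2, OF chain_grad_carrier]
          chain_grad_carrier assms(1)])
  then show ?thesis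
    using transpose_vec_mult_scalar[OF chain_grad_carrier assms(2) line_flow_carrier]
    by (simp add: line_flow_def)
qed

text \<open>Abel summation; \<open>S 0 = 0\<close> removes the lower boundary term.\<close>

lemma sum_forward_differences_mult:
  fixes f S :: "nat \<Rightarrow> real"
  assumes "S 0 = 0"
  shows "(\<Sum>e<m. (f (Suc e) - f e) * S (Suc e))
    = f m * S (Suc m) - (\<Sum>q<Suc m. f q * (S (Suc q) - S q))"
  by (induction m) (simp_all add: assms algebra_simps)

text \<open>Differences of the half-integer cosines are integer sines, and differences of these are
  the cosines again; each passage costs a factor \<open>2 * sin (x / 2)\<close> up to sign, which
  together make the eigenvalue. The orientation signs enter only as squares.\<close>

lemma line_flow_scalar_prod_eigvec:
  assumes n: "n \<ge> 1" and i: "i \<ge> 1" and \<theta>: "\<theta> \<in> carrier_vec n"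
    and \<epsilon>: "\<And>e. e < n - 1 \<Longrightarrow> \<epsilon> e = 1 \<or> \<epsilon> e = - 1"
  shows "line_flow n \<epsilon> \<theta> \<bullet> line_flow n \<epsilon> (chain_eigvec n i)
    = chain_eigval n i * chain_coeff n \<theta> i"
proof -
  define x where "x = pi * (real i - 1) / real n"
  define c where "c = 1 / chain_eigvec_norm n i"
  \<comment> \<open>Up to a constant factor, \<open>S\<close> is the discrete derivative of the
    eigenvector. It vanishes at 0 and at \<open>n\<close>, so both boundary terms of the summation
    by parts disappear.\<close>
  define S where "S q = sin (real q * x)" for q :: nat
  have v: "chain_eigvec n i $ q = c * cos (x * (real q + 1 / 2))" if "q < n" for q
    using that by (simp add: chain_eigvec_def x_def c_def add.commute)
  have sd: "S (Suc q) - S q = 2 * sin (x / 2) * cos (x * (real q + 1 / 2))" for q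
  proof -
    have "(real (Suc q) * x - real q * x) / 2 = x / 2"
      "(real (Suc q) * x + real q * x) / 2 = x * (real q + 1 / 2)"
      by (simp_all add: field_simps)
    then show ?thesis by (simp only: S_def sin_diff_sin)
  qed
  have cd: "cos (x * (real (Suc e) + 1 / 2)) - cos (x * (real e + 1 / 2))
      = - 2 * sin (x / 2) * S (Suc e)" for e
  proof -
    have "x * (real (Suc e) + 1 / 2) = real (Suc e) * x + x / 2"
      "x * (real e + 1 / 2) = real (Suc e) * x - x / 2"
      by (simp_all add: field_simps)
    then show ?thesis
      by (simp only: S_def cos_add cos_diff) simp
  qed
  have S0: "S 0 = 0" by (simp add: S_def)
  have "real n * x = real (i - 1) * pi"
    using n i by (simp add: x_def of_nat_diff)
  then have Sn: "S n = 0" by (simp only: S_def sin_npi)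
  have sq: "\<epsilon> e * \<epsilon> e = 1" if "e < n - 1" for e
    using \<epsilon>[OF that] by auto
  have "line_flow n \<epsilon> \<theta> \<bullet> line_flow n \<epsilon> (chain_eigvec n i)
      = (\<Sum>e<n - 1. line_flow n \<epsilon> \<theta> $ e * line_flow n \<epsilon> (chain_eigvec n i) $ e)"
    by (simp add: scalar_prod_def lessThan_atLeast0)
  also have "\<dots> = (\<Sum>e<n - 1. - 2 * c * sin (x / 2) * ((\<theta> $ Suc e - \<theta> $ e) * S (Suc e)))"
  proof (rule sum.cong[OF refl])
    fix e assume "e \<in> {..<n - 1}"
    then have e: "e < n - 1" by simp
    have "line_flow n \<epsilon> \<theta> $ e * line_flow n \<epsilon> (chain_eigvec n i) $ e
        = (\<epsilon> e * \<epsilon> e) * (\<theta> $ Suc e - \<theta> $ e)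
          * (chain_eigvec n i $ Suc e - chain_eigvec n i $ e)"
      using e \<theta> by (simp only: line_flow_index chain_eigvec_carrier mult_ac)
    also have "chain_eigvec n i $ Suc e - chain_eigvec n i $ e
        = c * (cos (x * (real (Suc e) + 1 / 2)) - cos (x * (real e + 1 / 2)))"
      using e by (subst v, simp)+ (simp only: right_diff_distrib)
    finally show "line_flow n \<epsilon> \<theta> $ e * line_flow n \<epsilon> (chain_eigvec n i) $ e
        = - 2 * c * sin (x / 2) * ((\<theta> $ Suc e - \<theta> $ e) * S (Suc e))"
      unfolding cd sq[OF e] by simp
  qed
  also have "\<dots> = - 2 * c * sin (x / 2) * (\<Sum>e<n - 1. (\<theta> $ Suc e - \<theta> $ e) * S (Suc e))"
    by (simp only: sum_distrib_left)
  also have "\<dots> = 2 * c * sin (x / 2) * (\<Sum>q<n. \<theta> $ q * (S (Suc q) - S q))"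
    using n Sn by (simp add: sum_forward_differences_mult[of S, OF S0])
  also have "\<dots> = 4 * (sin (x / 2))\<^sup>2 * (\<Sum>q<n. \<theta> $ q * chain_eigvec n i $ q)"
    unfolding sd sum_distrib_left by (rule sum.cong) (simp_all add: v power2_eq_square)
  also have "\<dots> = chain_eigval n i * chain_coeff n \<theta> i"
    by (simp add: chain_eigval_def chain_coeff_def scalar_prod_def lessThan_atLeast0 x_def mult.commute)
  finally show ?thesis .
qed

section \<open>The squared norm of the flow as a spectral sum\<close>

lemma chain_eigval_pos:
  assumes "2 \<le> i" "i \<le> n"
  shows "chain_eigval n i > 0"
proof -
  have "0 < pi * (real i - 1) / (2 * real n)"
    using assms by simp
  moreover have "pi * (real i - 1) < pi * (2 * real n)"
    using assms by (intro mult_strict_left_mono) auto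
  then have "pi * (real i - 1) / (2 * real n) < pi"
    using assms by (simp add: divide_less_eq)
  ultimately have "sin (pi * (real i - 1) / (2 * real n)) > 0" by (rule sin_gt_zero)
  then show ?thesis by (simp add: chain_eigval_def)
qed

lemma line_flow_norm_squared:
  assumes n: "n \<ge> 1" and \<epsilon>: "\<And>e. e < n - 1 \<Longrightarrow> \<epsilon> e = 1 \<or> \<epsilon> e = - 1"
    and \<theta>: "\<theta> \<in> carrier_vec n" and P: "(- chain_laplacian n \<epsilon>) *\<^sub>v \<theta> = P"
  shows "(euclidean_norm_vec (line_flow n \<epsilon> \<theta>))\<^sup>2 = s_squared n P n"
proof -
  have P': "P = - (chain_laplacian n \<epsilon> *\<^sub>v \<theta>)"
    using P \<theta> by auto
  have Pc: "P \<in> carrier_vec n"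
    unfolding P' by (rule carrier_vecI) simp
  \<comment> \<open>Used twice: with \<open>\<phi>\<close> an eigenvector it gives the coefficients
    of \<open>P\<close>, with \<open>\<phi> = \<theta>\<close> the squared norm of the flow.\<close>
  have weak: "P \<bullet> \<phi> = - (line_flow n \<epsilon> \<theta> \<bullet> line_flow n \<epsilon> \<phi>)" if "\<phi> \<in> carrier_vec n" for \<phi>
    using that \<theta> unfolding P' by (simp add: chain_laplacian_scalar_prod[symmetric])
  have coeff: "chain_coeff n P i = - (chain_eigval n i * chain_coeff n \<theta> i)" if "i \<ge> 1" for i
    unfolding chain_coeff_def[of n P]
    using weak line_flow_scalar_prod_eigvec[OF n that \<theta> \<epsilon>] by simp
  have "(euclidean_norm_vec (line_flow n \<epsilon> \<theta>))\<^sup>2 = line_flow n \<epsilon> \<theta> \<bullet> line_flow n \<epsilon> \<theta>"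
    by (simp add: euclidean_norm_vec_def L2_set_def scalar_prod_def sum_nonneg power2_eq_square
        lessThan_atLeast0)
  also have "\<dots> = (\<Sum>i = 1..n. - (chain_coeff n P i * chain_coeff n \<theta> i))"
    using weak[OF \<theta>] chain_parseval[OF Pc \<theta>] by (simp add: sum_negf)
  also have "\<dots> = (\<Sum>i = 2..n. - (chain_coeff n P i * chain_coeff n \<theta> i))"
  proof (rule sum.mono_neutral_right)
    \<comment> \<open>The eigenvalue at index 1 is 0. Hence the mean of \<open>\<theta>\<close>,
      which the equation leaves undetermined, does not contribute.\<close>
    have "chain_coeff n P 1 = 0" by (simp add: coeff chain_eigval_def)
    moreover have "{1..n} - {2..n} \<subseteq> {1}" by auto
    ultimately show "\<forall>i\<in>{1..n} - {2..n}. - (chain_coeff n P i * chain_coeff n \<theta> i) = 0"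
      by auto
  qed auto
  also have "\<dots> = s_squared n P n"
    unfolding s_squared_def
  proof (rule sum.cong[OF refl])
    fix i assume "i \<in> {2..n}"
    then show "- (chain_coeff n P i * chain_coeff n \<theta> i)
        = (chain_coeff n P i)\<^sup>2 / chain_eigval n i"
      using chain_eigval_pos[of i n] by (simp add: coeff power2_eq_square)
  qed
  finally show ?thesis .
qed

section \<open>The cotangent bound for the spectral tail\<close>

text \<open>By the mean value theorem the right side is \<open>(b - a) / (sin z)\<^sup>2\<close> for
  some \<open>z\<close> between \<open>a\<close> and \<open>b\<close>, and \<open>sin\<close>
  increases up to \<open>pi / 2\<close>.\<close>

lemma cot_diff_ge:
  fixes a b :: real
  assumes "0 < a" "a < b" "b \<le> pi / 2"
  shows "(b - a) / (sin b)\<^sup>2 \<le> cot a - cot b"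
proof -
  have "DERIV cot y :> - inverse ((sin y)\<^sup>2)" if "a \<le> y" "y \<le> b" for y
  proof (rule DERIV_cot)
    show "sin y \<noteq> 0" using sin_gt_zero[of y] that assms pi_gt_zero by auto
  qed
  with MVT2[OF assms(2), of cot "\<lambda>y. - inverse ((sin y)\<^sup>2)"] obtain z where z: "a < z" "z < b"
    and eq: "cot b - cot a = (b - a) * - inverse ((sin z)\<^sup>2)" by blast
  have pos: "sin z > 0" using sin_gt_zero[of z] z assms pi_gt_zero by auto
  have "sin z \<le> sin b"
    using z assms pi_gt_zero by (intro sin_monotone_2pi_le) auto
  then have "(sin z)\<^sup>2 \<le> (sin b)\<^sup>2" using pos by (intro power_mono) auto
  then have "(b - a) / (sin b)\<^sup>2 \<le> (b - a) / (sin z)\<^sup>2"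
    using pos assms by (intro divide_left_mono) (auto intro!: mult_pos_pos)
  also have "\<dots> = cot a - cot b" using eq by (simp add: divide_inverse)
  finally show ?thesis .
qed

lemma inverse_chain_eigval_le:
  assumes "2 \<le> i" "i < n"
  shows "1 / chain_eigval n (Suc i) \<le> real n / (2 * pi)
    * (cot (pi * (real i - 1) / (2 * real n)) - cot (pi * (real (Suc i) - 1) / (2 * real n)))"
proof -
  define a b where "a = pi * (real i - 1) / (2 * real n)"
    and "b = pi * (real (Suc i) - 1) / (2 * real n)"
  have ba: "b - a = pi / (2 * real n)"
    by (simp add: a_def b_def algebra_simps flip: diff_divide_distrib)
  have "0 < a" "a < b" "b \<le> pi / 2"
    using assms by (simp_all add: a_def b_def field_simps)
  then have "(b - a) / (sin b)\<^sup>2 \<le> cot a - cot b" by (rule cot_diff_ge)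
  then have "real n / (2 * pi) * ((b - a) / (sin b)\<^sup>2) \<le> real n / (2 * pi) * (cot a - cot b)"
    by (rule mult_left_mono) simp
  \<comment> \<open>The nodes are \<open>pi / (2 * n)\<close> apart, and \<open>n / (2 * pi)\<close>
    times this spacing is 1/4, the inverse of the constant in the eigenvalue.\<close>
  moreover have "real n / (2 * pi) * ((b - a) / (sin b)\<^sup>2) = 1 / chain_eigval n (Suc i)"
    unfolding ba chain_eigval_def b_def[symmetric] using assms by simp
  ultimately show ?thesis by (simp add: a_def b_def)
qed

text \<open>The cotangent differences telescope. The upper end \<open>m\<close> is kept apart from
  \<open>n\<close> so that the induction can move it while the nodes stay fixed.\<close>

lemma sum_inverse_chain_eigval_le:
  assumes "2 \<le> k" "k \<le> m" "m \<le> n"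
  shows "(\<Sum>i = k + 1..m. 1 / chain_eigval n i) \<le> real n / (2 * pi)
    * (cot (pi * (real k - 1) / (2 * real n)) - cot (pi * (real m - 1) / (2 * real n)))"
  using assms(2,3)
proof (induction m rule: dec_induct)
  case base
  show ?case by simp
next
  case (step m)
  with inverse_chain_eigval_le[of m n] assms(1) show ?case
    by (simp add: algebra_simps)
qed

theorem mainTheorem3:
  fixes n k :: nat and P \<theta> :: "real vec" and \<epsilon> :: "nat \<Rightarrow> real"
  assumes "n \<ge> 3"
    and "\<And>e. e < n - 1 \<Longrightarrow> \<epsilon> e = 1 \<or> \<epsilon> e = - 1"
    and "P \<in> carrier_vec n"
    and "(\<Sum>q<n. vec_index P q) = 0"
    and "\<theta> \<in> carrier_vec n"
    and "mult_mat_vec (- chain_laplacian n \<epsilon>) \<theta> = P"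
    and "2 \<le> k" and "k \<le> n - 1"
  shows "delta n \<epsilon> P \<theta> k \<le>
    real n / (2 * pi) * Max ((\<lambda>i. (chain_coeff n P i)\<^sup>2) ` {k + 1..n})
      * (cot (pi * (real k - 1) / (2 * real n)) - cot (pi * (real n - 1) / (2 * real n)))"
proof -
  define M where "M = Max ((\<lambda>i. (chain_coeff n P i)\<^sup>2) ` {k + 1..n})"
  have M: "(chain_coeff n P i)\<^sup>2 \<le> M" if "i \<in> {k + 1..n}" for i
    unfolding M_def using that by (intro Max_ge) auto
  \<comment> \<open>Index \<open>n\<close> witnesses that the range of the maximum is nonempty;
    \<open>M \<ge> 0\<close> later allows the bound on the tail to be multiplied by
    \<open>M\<close>.\<close>
  have "0 \<le> (chain_coeff n P n)\<^sup>2" by simp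
  also have "\<dots> \<le> M" using assms by (intro M) auto
  finally have M0: "0 \<le> M" .
  \<comment> \<open>Cutting the full spectral sum at \<open>k\<close> leaves exactly its tail as
    \<open>delta\<close>.\<close>
  have "s_squared n P n = s_squared n P k
      + (\<Sum>i = k + 1..n. (chain_coeff n P i)\<^sup>2 / chain_eigval n i)"
    unfolding s_squared_def using assms sum.ub_add_nat[of 2 k _ "n - k"] by simp
  moreover have "(euclidean_norm_vec (line_flow n \<epsilon> \<theta>))\<^sup>2 = s_squared n P n"
    using assms by (intro line_flow_norm_squared) auto
  ultimately have "delta n \<epsilon> P \<theta> k = (\<Sum>i = k + 1..n. (chain_coeff n P i)\<^sup>2 / chain_eigval n i)"
    by (simp add: delta_def)
  also have "\<dots> \<le> (\<Sum>i = k + 1..n. M * (1 / chain_eigval n i))"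
  proof (rule sum_mono)
    fix i assume i: "i \<in> {k + 1..n}"
    then have "chain_eigval n i > 0" using assms by (intro chain_eigval_pos) auto
    then show "(chain_coeff n P i)\<^sup>2 / chain_eigval n i \<le> M * (1 / chain_eigval n i)"
      using M[OF i] by (simp add: divide_right_mono)
  qed
  also have "\<dots> = M * (\<Sum>i = k + 1..n. 1 / chain_eigval n i)"
    by (simp only: sum_distrib_left)
  also have "\<dots> \<le> M * (real n / (2 * pi)
      * (cot (pi * (real k - 1) / (2 * real n)) - cot (pi * (real n - 1) / (2 * real n))))"
    using M0 assms by (intro mult_left_mono sum_inverse_chain_eigval_le) auto
  finally show ?thesis by (simp only: M_def mult_ac)
qed

end
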